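(* Let $0<\lambda<\lambda_0\le\lambda_{\max}$ and $\ell\in\{1,\ldots,d\}$. Write $\mathbf{o}=\mathbf{o}(\lambda,\lambda_0)$ and $\Delta=\tfrac12\|\mathbf{r}^{\perp}(\lambda,\lambda_0)\|$, with $\Delta>0$. Let $$H=-\operatorname{diag}\big(2\|\mathbf{x}_\ell^{(1)}\|,\ldots,2\|\mathbf{x}_\ell^{(T)}\|\big),$$ $$\mathbf{q}=-\Big(2\|\mathbf{x}_\ell^{(1)}\|\,|\langle\mathbf{x}_\ell^{(1)},\mathbf{o}_1\rangle|,\ldots,2\|\mathbf{x}_\ell^{(T)}\|\,|\langle\mathbf{x}_\ell^{(T)},\mathbf{o}_T\rangle|\Big)^{\top}\in\mathbb{R}^T,$$ and let $\mathbf{u}^*$ be the optimal solution of $$\min_{\mathbf{u}\in\mathbb{R}^T,\ \|\mathbf{u}\|\le\Delta}\ \psi(\mathbf{u})=\tfrac12\mathbf{u}^{\top}H\mathbf{u}+\mathbf{q}^{\top}\mathbf{u};$$ namely, there exists $\alpha^*\ge0$ such that $H+\alpha^*I$ is positive semidefinite, $(H+\alpha^*I)\mathbf{u}^*=-\mathbf{q}$, and $\|\mathbf{u}^*\|=\Delta$ if $\alpha^*>0$. Let $$\rho_\ell=\max_{t=1,\ldots,T}\|\mathbf{x}_\ell^{(t)}\|,\qquad \mathcal{I}_\ell=\{t_*:\ \|\mathbf{x}_\ell^{(t_* )}\|=\rho_\ell\}.$$ Then the following hold: 1. $\alpha^*$ is unique, and $\alpha^*\ge2\rho_\ell$. 2.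 Define $\bar{\mathbf{u}}\in\mathbb{R}^T$ by $\bar u_t=-q_t/(h_{tt}+2\rho_\ell)$ if $t\notin\mathcal{I}_\ell$ and $\bar u_t=0$ otherwise, where $h_{tt}$ is the $t$-th diagonal entry of $H$. If $\|\bar{\mathbf{u}}\|\le\Delta$ and $\langle\mathbf{x}_\ell^{(t_* )},\mathbf{o}_{t_*}\rangle=0$ for $t_*\in\mathcal{I}_\ell$, then $\alpha^*=2\rho_\ell$; otherwise $\alpha^*\in(2\rho_\ell,\infty)$. 3. Let $\mathcal{V}=\{\mathbf{v}\in\mathbb{R}^T:\ v_t=0\text{ for }t\notin\mathcal{I}_\ell,\ \|\bar{\mathbf{u}}+\mathbf{v}\|=\Delta\}$. If $\alpha^*=2\rho_\ell$, then $\mathbf{u}^*\in\{\bar{\mathbf{u}}+\mathbf{v}:\ \mathbf{v}\in\mathcal{V}\}$; otherwise $\mathbf{u}^*=-(H+\alpha^*I)^{-1}\mathbf{q}$. 4. The maximum value $s_\ell(\lambda,\lambda_0)=\max_{\theta\in\mathbf{\Theta}(\lambda,\lambda_0)}g_\ell(\theta)$ is given by $$s_\ell(\lambda,\lambda_0)=\sum_{t=1}^T\langle\mathbf{x}_\ell^{(t)},\mathbf{o}_t\rangle^2+\frac{\alpha^*}{2}\Delta^2-\frac12\mathbf{q}^{\top}\mathbf{u}^*.$$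
   Context: Let $T,d,N_1,\ldots,N_T$ be positive integers and $N=\sum_{t=1}^T N_t$. For $t=1,\ldots,T$ let $X_t\in\mathbb{R}^{N_t\times d}$ be a data matrix with $\ell$-th column $\mathbf{x}_\ell^{(t)}\in\mathbb{R}^{N_t}$, and let $\mathbf{y}_t\in\mathbb{R}^{N_t}$. Vectors $\theta\in\mathbb{R}^N$ are partitioned into blocks $\theta=(\theta_1,\ldots,\theta_T)$ with $\theta_t\in\mathbb{R}^{N_t}$ (so $\mathbf{o}_t$ is the $t$-th block of $\mathbf{o}$), and $\mathbf{y}=(\mathbf{y}_1,\ldots,\mathbf{y}_T)\in\mathbb{R}^N$. $\|\cdot\|$ is the Euclidean norm and $I$ is the identity matrix. For $\ell=1,\ldots,d$ let $g_\ell(\theta)=\sum_{t=1}^T\langle\mathbf{x}_\ell^{(t)},\theta_t\rangle^2$ on $\mathbb{R}^N$. Let $$\mathcal{F}=\{\theta\in\mathbb{R}^N:\ g_\ell(\theta)\le1,\ \ell=1,\ldots,d\},\qquad \lambda_{\max}=\max_{\ell=1,\ldots,d}\sqrt{\sum_{t=1}^T\langle\mathbf{x}_\ell^{(t)},\mathbf{y}_t\rangle^2}.$$ For $\lambda>0$ let $\theta^*(\lambda)=\mathrm{P}_{\mathcal{F}}(\mathbf{y}/\lambda)$ be the Euclidean projection of $\mathbf{y}/\lambda$ onto $\mathcal{F}$. Fix $\ell_*\in\operatorname{argmax}_\ell g_\ell(\mathbf{y})$. For $0<\lambda<\lambda_0\le\lambda_{\max}$ define $$\mathbf{n}(\lambda_0)=\begin{cases}\mathbf{y}/\lambda_0-\theta^*(\lambda_0),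 & \lambda_0<\lambda_{\max},\\ \nabla g_{\ell_*}(\mathbf{y}/\lambda_{\max}), & \lambda_0=\lambda_{\max},\end{cases}\qquad \mathbf{r}(\lambda,\lambda_0)=\frac{\mathbf{y}}{\lambda}-\theta^*(\lambda_0),$$ $$\mathbf{r}^{\perp}(\lambda,\lambda_0)=\mathbf{r}(\lambda,\lambda_0)-\frac{\langle\mathbf{n}(\lambda_0),\mathbf{r}(\lambda,\lambda_0)\rangle}{\|\mathbf{n}(\lambda_0)\|^2}\mathbf{n}(\lambda_0),\qquad \mathbf{o}(\lambda,\lambda_0)=\theta^*(\lambda_0)+\tfrac12\mathbf{r}^{\perp}(\lambda,\lambda_0),$$ $$\mathbf{\Theta}(\lambda,\lambda_0)=\left\{\theta\in\mathbb{R}^N:\ \|\theta-\mathbf{o}(\lambda,\lambda_0)\|\le\tfrac12\|\mathbf{r}^{\perp}(\lambda,\lambda_0)\|\right\}.$$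
   Formalization: H is corrected to -diag(2‖x_ℓ^(t)‖²) and 2ρ_ℓ to 2ρ_ℓ² throughout, since claim 4 fails as printed; the first half of claim 3 is asserted only if ρ_ℓ>0 or ‖u*‖=Δ, since it fails for interior optimal u* when all x_ℓ^(t)=0. *)

theory Defs
  imports "HOL-Analysis.Analysis"
begin

text \<open>
  The stacked space of dimension N = N_1 + ... + N_T is \<open>real^'n\<close>, the T tasks are the elements of
  \<open>'t\<close> and the d features are the elements of \<open>'d\<close>.  A map \<open>blk :: 'n \<Rightarrow> 't\<close> tells to which task a
  coordinate belongs, so N_t is the cardinality of \<open>blk -` {t}\<close>; all N_t are positive iff \<open>blk\<close>
  is surjective.  The matrices X_1, ..., X_T are stacked on top of each other in
  \<open>X :: real^'d^'n\<close>, and the vectors y_1, ..., y_T in \<open>y :: real^'n\<close>.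

  The t-th block of a vector is kept inside \<open>real^'n\<close>, with zeros outside block t.  Norms of
  blocks and inner products of blocks with the same index are those of the N_t-dimensional space.
\<close>

definition block :: "('n::finite \<Rightarrow> 't) \<Rightarrow> 't \<Rightarrow> real^'n \<Rightarrow> real^'n" where
  "block blk t \<theta> = (\<chi> i. if blk i = t then \<theta> $ i else 0)"

definition feature :: "('n::finite \<Rightarrow> 't) \<Rightarrow> real^'d^'n \<Rightarrow> 'd::finite \<Rightarrow> 't \<Rightarrow> real^'n" where
  "feature blk X l t = block blk t (column l X)"

definition constr ::
  "('n::finite \<Rightarrow> 't::finite) \<Rightarrow> real^'d^'n \<Rightarrow> 'd::finite \<Rightarrow> real^'n \<Rightarrow> real" where
  "constr blk X l \<theta> = (\<Sum>t\<in>UNIV. (feature blk X l t \<bullet> block blk t \<theta>)\<^sup>2)"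

definition dual_feasible ::
  "('n::finite \<Rightarrow> 't::finite) \<Rightarrow> real^'d::finite^'n \<Rightarrow> (real^'n) set" where
  "dual_feasible blk X = {\<theta>. \<forall>l. constr blk X l \<theta> \<le> 1}"

definition lambda_max ::
  "('n::finite \<Rightarrow> 't::finite) \<Rightarrow> real^'d::finite^'n \<Rightarrow> real^'n \<Rightarrow> real" where
  "lambda_max blk X y =
     (MAX l. sqrt (\<Sum>t\<in>UNIV. (feature blk X l t \<bullet> block blk t y)\<^sup>2))"

definition dual_opt ::
  "('n::finite \<Rightarrow> 't::finite) \<Rightarrow> real^'d::finite^'n \<Rightarrow> real^'n \<Rightarrow> real \<Rightarrow> real^'n" where
  "dual_opt blk X y lam = closest_point (dual_feasible blk X) (y /\<^sub>R lam)"

definition grad :: "('a::real_inner \<Rightarrow> real) \<Rightarrow> 'a \<Rightarrow> 'a" where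
  "grad f x = (THE D. GDERIV f x :> D)"

text \<open>
  In the following definitions \<open>ls\<close> is the fixed index in the argmax of \<open>\<lambda>l. constr blk X l y\<close>.
\<close>

definition normal_vec ::
  "('n::finite \<Rightarrow> 't::finite) \<Rightarrow> real^'d::finite^'n \<Rightarrow> real^'n \<Rightarrow> 'd \<Rightarrow> real \<Rightarrow> real^'n" where
  "normal_vec blk X y ls lam0 =
     (if lam0 < lambda_max blk X y
      then y /\<^sub>R lam0 - dual_opt blk X y lam0
      else grad (constr blk X ls) (y /\<^sub>R lambda_max blk X y))"

definition resid ::
  "('n::finite \<Rightarrow> 't::finite) \<Rightarrow> real^'d::finite^'n \<Rightarrow> real^'n \<Rightarrow> real \<Rightarrow> real \<Rightarrow> real^'n" where
  "resid blk X y lam lam0 = y /\<^sub>R lam - dual_opt blk X y lam0"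

definition resid_perp ::
  "('n::finite \<Rightarrow> 't::finite) \<Rightarrow> real^'d::finite^'n \<Rightarrow> real^'n \<Rightarrow> 'd \<Rightarrow> real \<Rightarrow> real \<Rightarrow> real^'n" where
  "resid_perp blk X y ls lam lam0 =
     resid blk X y lam lam0
     - ((normal_vec blk X y ls lam0 \<bullet> resid blk X y lam lam0) / (norm (normal_vec blk X y ls lam0))\<^sup>2)
         *\<^sub>R normal_vec blk X y ls lam0"

definition center ::
  "('n::finite \<Rightarrow> 't::finite) \<Rightarrow> real^'d::finite^'n \<Rightarrow> real^'n \<Rightarrow> 'd \<Rightarrow> real \<Rightarrow> real \<Rightarrow> real^'n" where
  "center blk X y ls lam lam0 =
     dual_opt blk X y lam0 + (1/2) *\<^sub>R resid_perp blk X y ls lam lam0"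

definition dual_ball ::
  "('n::finite \<Rightarrow> 't::finite) \<Rightarrow> real^'d::finite^'n \<Rightarrow> real^'n \<Rightarrow> 'd \<Rightarrow> real \<Rightarrow> real \<Rightarrow> (real^'n) set" where
  "dual_ball blk X y ls lam lam0 =
     {\<theta>. norm (\<theta> - center blk X y ls lam lam0) \<le> (1/2) * norm (resid_perp blk X y ls lam lam0)}"

definition pos_semidef :: "real^'t^'t::finite \<Rightarrow> bool" where
  "pos_semidef A \<longleftrightarrow> transpose A = A \<and> (\<forall>v. 0 \<le> v \<bullet> (A *v v))"

definition tr_objective :: "real^'t^'t::finite \<Rightarrow> real^'t \<Rightarrow> real^'t \<Rightarrow> real" where
  "tr_objective H q u = (1/2) * (u \<bullet> (H *v u)) + q \<bullet> u"

definition tr_optimal :: "real^'t^'t::finite \<Rightarrow> real^'t \<Rightarrow> real \<Rightarrow> real^'t \<Rightarrow> bool" where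
  "tr_optimal H q \<Delta> u \<longleftrightarrow> is_arg_min (tr_objective H q) (\<lambda>w. norm w \<le> \<Delta>) u"

definition tr_multiplier ::
  "real^'t^'t::finite \<Rightarrow> real^'t \<Rightarrow> real \<Rightarrow> real^'t \<Rightarrow> real \<Rightarrow> bool" where
  "tr_multiplier H q \<Delta> u \<alpha> \<longleftrightarrow>
     0 \<le> \<alpha> \<and> pos_semidef (H + \<alpha> *\<^sub>R mat 1) \<and> (H + \<alpha> *\<^sub>R mat 1) *v u = - q
     \<and> (0 < \<alpha> \<longrightarrow> norm u = \<Delta>)"

end

theory Submission
  imports Defs
begin

text \<open>
  Writing \<open>\<theta> = o + \<delta>\<close> and applying Cauchy-Schwarz in each block turns the maximisation of the
  constraint over the ball into the trust region problem for the block norms of \<open>\<delta>\<close>.  Since its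
  matrix is diagonal, a multiplier is found by solving the secular equation
  \<open>\<Sum>\<^sub>t (q\<^sub>t / (\<alpha> + h\<^sub>t\<^sub>t))\<^sup>2 = \<Delta>\<^sup>2\<close> with the intermediate value theorem, except in the degenerate case, where
  \<open>\<alpha> = 2\<rho>\<^sup>2\<close> works.  A multiplier of one solution is a multiplier of every optimal point, because
  the objective differs from its minimum by a positive semidefinite form plus a nonnegative term.
\<close>

section \<open>Trust region problems\<close>

lemma matrix_shift_mult:
  fixes H :: "real^'t^'t::finite"
  shows "(H + b *\<^sub>R mat 1) *v v = H *v v + b *\<^sub>R v"
  by (simp add: matrix_vector_mult_add_rdistrib scaleR_matrix_vector_assoc[symmetric])

lemma symmetric_inner_commute:
  fixes A :: "real^'t^'t::finite"
  assumes "transpose A = A"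
  shows "v \<bullet> (A *v w) = w \<bullet> (A *v v)"
  by (metis assms dot_lmul_matrix inner_commute transpose_matrix_vector)

text \<open>At a zero of the form, a step from \<open>v\<close> along \<open>- A *v v\<close> lowers
  its value to first order, which would make it negative unless \<open>A *v v = 0\<close>.\<close>

lemma pos_semidef_null:
  fixes A :: "real^'t^'t::finite"
  assumes A: "pos_semidef A" and v: "v \<bullet> (A *v v) = 0"
  shows "A *v v = 0"
proof -
  \<comment> \<open>\<open>s\<close> is close to the minimising step length; the \<open>+ 1\<close>
    keeps its denominator positive even if \<open>c = 0\<close>.\<close>
  define z c s where "z = A *v v" and "c = z \<bullet> (A *v z)" and "s = (z \<bullet> z) / (c + 1)"
  have c: "0 \<le> c" using A by (simp add: pos_semidef_def c_def)
  have sym: "v \<bullet> (A *v z) = z \<bullet> z"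
    using A symmetric_inner_commute[of A v z] by (simp add: pos_semidef_def z_def)
  have "0 \<le> (v - s *\<^sub>R z) \<bullet> (A *v (v - s *\<^sub>R z))"
    using A by (simp add: pos_semidef_def)
  also have "\<dots> = s * (s * c - 2 * (z \<bullet> z))"
    using v sym
    by (simp add: matrix_vector_mult_diff_distrib matrix_vector_mult_scaleR inner_diff
        c_def z_def[symmetric] algebra_simps)
  also have "s * c - 2 * (z \<bullet> z) = - (z \<bullet> z) * (c + 2) / (c + 1)"
    using c by (simp add: s_def field_simps)
  also have "s * \<dots> = - ((z \<bullet> z)\<^sup>2 * ((c + 2) / (c + 1)\<^sup>2))"
    by (simp add: s_def power2_eq_square)
  finally have "(z \<bullet> z)\<^sup>2 * ((c + 2) / (c + 1)\<^sup>2) \<le> 0" by simp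
  moreover have "0 < (c + 2) / (c + 1)\<^sup>2" using c by simp
  ultimately have "z \<bullet> z = 0"
    by (metis mult_le_0_iff not_le power2_less_eq_zero_iff zero_le_power2 order.antisym)
  then show ?thesis by (simp add: z_def)
qed

text \<open>Completing the square: the objective is the quadratic function of
  \<open>H + b *\<^sub>R mat 1\<close>, which is stationary at \<open>u\<close>, minus
  \<open>b / 2\<close> times the squared norm. No sign of \<open>b\<close> and no definiteness
  enters, so the identity serves both for sufficiency and for comparing two minimisers.\<close>

lemma tr_objective_diff:
  fixes H :: "real^'t^'t::finite"
  assumes sym: "transpose (H + b *\<^sub>R mat 1) = H + b *\<^sub>R mat 1"
    and stat: "(H + b *\<^sub>R mat 1) *v u = - q"
  shows "tr_objective H q w - tr_objective H q u =
    (1/2) * ((w - u) \<bullet> ((H + b *\<^sub>R mat 1) *v (w - u))) + b / 2 * ((norm u)\<^sup>2 - (norm w)\<^sup>2)"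
proof -
  define A where "A = H + b *\<^sub>R mat 1"
  have H: "H *v v = A *v v - b *\<^sub>R v" for v
    by (simp add: A_def matrix_shift_mult)
  have q: "q = - (A *v u)" using stat by (simp add: A_def)
  have "u \<bullet> (A *v w) = w \<bullet> (A *v u)"
    using sym by (intro symmetric_inner_commute) (simp add: A_def)
  then show ?thesis
    unfolding A_def[symmetric] tr_objective_def H q
    by (simp add: matrix_vector_mult_diff_distrib inner_diff inner_commute[of "A *v u"]
        power2_norm_eq_inner algebra_simps add_divide_distrib diff_divide_distrib)
qed

text \<open>Stationarity eliminates \<open>H\<close> and complementarity turns
  \<open>b * (u \<bullet> u)\<close> into \<open>b * \<Delta>\<^sup>2\<close>; this is the source of
  the closed form of the maximum.\<close>

lemma tr_objective_multiplier:
  assumes "tr_multiplier H q \<Delta> u b"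
  shows "tr_objective H q u = (1/2) * (q \<bullet> u) - b / 2 * \<Delta>\<^sup>2"
proof -
  have Hu: "H *v u = - q - b *\<^sub>R u"
    using assms matrix_shift_mult[of H b u] by (simp add: tr_multiplier_def eq_diff_eq)
  have "b * (u \<bullet> u) = b * \<Delta>\<^sup>2"
    using assms by (cases "b = 0") (auto simp: tr_multiplier_def power2_norm_eq_inner[symmetric])
  then show ?thesis
    unfolding tr_objective_def Hu by (simp add: inner_diff_right inner_commute[of u q] diff_divide_distrib)
qed

lemma tr_multiplier_imp_optimal:
  assumes b: "tr_multiplier H q \<Delta> u b" and u: "norm u \<le> \<Delta>"
  shows "tr_optimal H q \<Delta> u"
proof -
  have "tr_objective H q u \<le> tr_objective H q w" if w: "norm w \<le> \<Delta>" for w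
  proof -
    have "0 \<le> b * ((norm u)\<^sup>2 - (norm w)\<^sup>2)"
      using b w by (cases "b = 0") (auto simp: tr_multiplier_def power_mono)
    moreover have "0 \<le> (w - u) \<bullet> ((H + b *\<^sub>R mat 1) *v (w - u))"
      using b by (simp add: tr_multiplier_def pos_semidef_def)
    moreover have "tr_objective H q w - tr_objective H q u =
        (1/2) * ((w - u) \<bullet> ((H + b *\<^sub>R mat 1) *v (w - u))) + b / 2 * ((norm u)\<^sup>2 - (norm w)\<^sup>2)"
      using b by (intro tr_objective_diff) (auto simp: tr_multiplier_def pos_semidef_def)
    ultimately show ?thesis by simp
  qed
  then show ?thesis
    using u by (auto simp: tr_optimal_def is_arg_min_def not_less)
qed

text \<open>Between two minimisers both nonnegative terms of \<open>tr_objective_diff\<close>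
  vanish. The first gives \<open>w\<close> the same stationarity equation as \<open>u\<close>, the
  second puts \<open>w\<close> on the sphere when \<open>b > 0\<close>.\<close>

lemma tr_multiplier_all_optimal:
  assumes b: "tr_multiplier H q \<Delta> u b" and u: "norm u \<le> \<Delta>" and w: "tr_optimal H q \<Delta> w"
  shows "tr_multiplier H q \<Delta> w b"
proof -
  let ?A = "H + b *\<^sub>R mat 1"
  have nw: "norm w \<le> \<Delta>" and le: "tr_objective H q w \<le> tr_objective H q u"
    using w u by (auto simp: tr_optimal_def is_arg_min_def not_less)
  have psd: "pos_semidef ?A" and stat: "?A *v u = - q" and b0: "0 \<le> b"
    and nu: "0 < b \<longrightarrow> norm u = \<Delta>"
    using b by (auto simp: tr_multiplier_def)
  have t1: "0 \<le> b * ((norm u)\<^sup>2 - (norm w)\<^sup>2)"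
    using b0 nu nw by (cases "b = 0") (auto simp: power_mono)
  have t2: "0 \<le> (w - u) \<bullet> (?A *v (w - u))"
    using psd by (simp add: pos_semidef_def)
  have "(1/2) * ((w - u) \<bullet> (?A *v (w - u))) + b / 2 * ((norm u)\<^sup>2 - (norm w)\<^sup>2) \<le> 0"
    using tr_objective_diff[of H b u q w] psd stat le by (simp add: pos_semidef_def)
  then have z1: "(w - u) \<bullet> (?A *v (w - u)) = 0" and z2: "b * ((norm u)\<^sup>2 - (norm w)\<^sup>2) = 0"
    using t1 t2 by linarith+
  have "?A *v w = - q"
    using pos_semidef_null[OF psd z1] stat
    by (simp only: matrix_vector_mult_diff_distrib right_minus_eq)
  moreover have "norm w = \<Delta>" if "0 < b"
    using z2 that nu by (auto simp: power2_eq_iff_nonneg)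
  ultimately show ?thesis
    using psd b0 by (simp add: tr_multiplier_def)
qed

text \<open>Subtracting the two stationarity equations leaves
  \<open>(a - b) *\<^sub>R u = 0\<close>. If \<open>u = 0\<close>, complementarity with
  \<open>\<Delta> > 0\<close> forces both multipliers to be 0.\<close>

lemma tr_multiplier_unique:
  assumes "tr_multiplier H q \<Delta> u a" "tr_multiplier H q \<Delta> u b" "0 < \<Delta>"
  shows "a = b"
proof (rule ccontr)
  assume ne: "a \<noteq> b"
  then have "u \<noteq> 0"
    using assms by (auto simp: tr_multiplier_def)
  moreover have "H *v u + a *\<^sub>R u = H *v u + b *\<^sub>R u"
    using assms by (metis matrix_shift_mult tr_multiplier_def)
  ultimately show False using ne by simp
qed

section \<open>Diagonal matrices\<close>

lemma diagonal_mult: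
  fixes d :: "'t::finite \<Rightarrow> real"
  shows "(\<chi> i j. if i = j then d i else 0) *v v = (\<chi> i. d i * v $ i)"
  by (simp add: vec_eq_iff matrix_vector_mult_def if_distrib[of "\<lambda>z. z * _"] cong: if_cong)

lemma diagonal_pos_semidef:
  fixes d :: "'t::finite \<Rightarrow> real"
  assumes "\<And>i. 0 \<le> d i"
  shows "pos_semidef (\<chi> i j. if i = j then d i else 0)"
proof -
  have "0 \<le> v \<bullet> (\<chi> i. d i * v $ i)" for v :: "real^'t"
    using assms by (auto simp: inner_vec_def mult.left_commute[of _ "d _"] intro!: sum_nonneg)
  then show ?thesis
    unfolding pos_semidef_def diagonal_mult by (auto simp: transpose_def vec_eq_iff)
qed

lemma diagonal_invertible:
  fixes d :: "'t::finite \<Rightarrow> real"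
  assumes "\<And>i. d i \<noteq> 0"
  shows "invertible (\<chi> i j. if i = j then d i else 0)"
proof (subst invertible_left_inverse, intro exI)
  show "(\<chi> i j. if i = j then 1 / d i else 0) ** (\<chi> i j. if i = j then d i else 0) = mat 1"
    using assms
    by (auto simp: vec_eq_iff matrix_matrix_mult_def mat_def if_distrib[of "\<lambda>z. z * _"] cong: if_cong)
qed

lemma matrix_inv_mult_vector:
  fixes A :: "real^'t^'t::finite"
  assumes "invertible A"
  shows "matrix_inv A *v (A *v v) = v"
proof -
  have "A ** matrix_inv A = mat 1 \<and> matrix_inv A ** A = mat 1"
    using assms unfolding invertible_def matrix_inv_def by (rule someI_ex)
  then show ?thesis by (simp add: matrix_vector_mul_assoc)
qed

text \<open>Here \<open>- d t\<close> plays the role of the diagonal of \<open>H\<close>, and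
  \<open>neg\<close> is the failure of the degenerate case. The left side of the equation is at
  least \<open>D\<^sup>2\<close> at some point right of, or at, \<open>m\<close>, is at most
  \<open>D\<^sup>2\<close> far out, and has no poles in between.\<close>

lemma secular_equation:
  fixes d q :: "'t::finite \<Rightarrow> real"
  assumes d: "\<And>t. d t \<le> m" and D: "0 < D"
    and neg: "\<not> ((\<Sum>t\<in>UNIV. (if d t < m then q t / (m - d t) else 0)\<^sup>2) \<le> D\<^sup>2 \<and>
                  (\<forall>t. d t = m \<longrightarrow> q t = 0))"
  obtains a where "m < a" "(\<Sum>t\<in>UNIV. (q t / (a - d t))\<^sup>2) = D\<^sup>2"
proof -
  \<comment> \<open>Summing only over \<open>q t \<noteq> 0\<close> removes the spurious
    singularities 0/0, so that \<phi> can be continuous at \<open>m\<close> itself.\<close>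
  define \<phi> where "\<phi> a = (\<Sum>t | q t \<noteq> 0. (q t / (a - d t))\<^sup>2)" for a
  have \<phi>_eq: "(\<Sum>t\<in>UNIV. (q t / (a - d t))\<^sup>2) = \<phi> a" for a
    unfolding \<phi>_def by (rule sum.mono_neutral_right) auto
  \<comment> \<open>The left endpoint. It is \<open>m\<close> if \<open>q\<close> vanishes wherever
    \<open>d t = m\<close>; otherwise a pole at \<open>m\<close> forces it to the right. The extra
    facts for \<open>a0 = m\<close> give continuity there and later exclude the solution
    \<open>a = m\<close>.\<close>
  have "\<exists>a0\<ge>m. D\<^sup>2 \<le> \<phi> a0 \<and> (a0 = m \<longrightarrow> D\<^sup>2 < \<phi> a0 \<and> (\<forall>t. q t \<noteq> 0 \<longrightarrow> d t < m))"
  proof (cases "\<forall>t. d t = m \<longrightarrow> q t = 0")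
    case True
    have "(\<Sum>t\<in>UNIV. (if d t < m then q t / (m - d t) else 0)\<^sup>2) = \<phi> m"
      unfolding \<phi>_eq[symmetric] by (rule sum.cong) (use d True in \<open>auto simp: not_less order.antisym\<close>)
    then show ?thesis
      using neg True d by (intro exI[of _ m]) (auto simp: less_le)
  next
    case False
    then obtain t where t: "d t = m" "q t \<noteq> 0" by blast
    \<comment> \<open>The point is chosen so that the summand of \<open>t\<close> alone equals
      \<open>D\<^sup>2\<close>.\<close>
    have "D\<^sup>2 = (q t / ((m + \<bar>q t\<bar> / D) - d t))\<^sup>2"
      using t D by (simp add: field_simps)
    also have "\<dots> \<le> \<phi> (m + \<bar>q t\<bar> / D)"
      unfolding \<phi>_def using t by (intro member_le_sum) auto
    finally show ?thesis
      using t D by (intro exI[of _ "m + \<bar>q t\<bar> / D"]) auto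
  qed
  then obtain a0 where a0: "m \<le> a0" "D\<^sup>2 \<le> \<phi> a0"
    and a0m: "a0 = m \<Longrightarrow> D\<^sup>2 < \<phi> a0" "\<And>t. a0 = m \<Longrightarrow> q t \<noteq> 0 \<Longrightarrow> d t < m"
    by blast
  have pos: "0 < a - d t" if "a0 \<le> a" "q t \<noteq> 0" for a t
    using a0(1) a0m(2)[of t] d[of t] that by (cases "a0 = m") auto
  \<comment> \<open>\<open>K\<close> is the norm of \<open>q\<close>. At \<open>b\<close> every
    denominator is at least \<open>K / D\<close>, so the sum is at most
    \<open>K\<^sup>2 / (K / D)\<^sup>2 = D\<^sup>2\<close>; the case \<open>K = 0\<close> is
    separate because this bound would divide by 0.\<close>
  define K where "K = sqrt (\<Sum>t\<in>UNIV. (q t)\<^sup>2)"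
  define b where "b = a0 + K / D"
  have K: "0 \<le> K" by (simp add: K_def sum_nonneg)
  have b: "a0 \<le> b" using K D by (simp add: b_def)
  have "\<phi> b \<le> D\<^sup>2"
  proof (cases "K = 0")
    case True
    then have "\<forall>t. q t = 0" by (auto simp: K_def sum_nonneg_eq_0_iff)
    then show ?thesis by (simp add: \<phi>_def)
  next
    case False
    then have Kp: "0 < K" using K by simp
    have "\<phi> b \<le> (\<Sum>t\<in>UNIV. (q t / (K / D))\<^sup>2)"
      unfolding \<phi>_eq[symmetric]
    proof (rule sum_mono)
      fix t
      have "0 < K / D" "K / D \<le> b - d t"
        using Kp D d[of t] a0(1) by (auto simp: b_def)
      then have "0 < (K / D)\<^sup>2" "(K / D)\<^sup>2 \<le> (b - d t)\<^sup>2"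
        using zero_less_power[of "K / D" 2] power_mono[of "K / D" "b - d t" 2] by linarith+
      then show "(q t / (b - d t))\<^sup>2 \<le> (q t / (K / D))\<^sup>2"
        unfolding power_divide[of "q t"] by (intro divide_left_mono mult_pos_pos) (simp_all only: zero_le_power2)
    qed
    also have "\<dots> = K\<^sup>2 / (K / D)\<^sup>2"
      unfolding power_divide[of "q _"] sum_divide_distrib[symmetric] by (simp add: K_def sum_nonneg)
    also have "\<dots> = D\<^sup>2" using Kp D by (simp add: field_simps)
    finally show ?thesis .
  qed
  moreover have "continuous_on {a0..b} \<phi>"
    unfolding \<phi>_def by (intro continuous_intros) (use pos in force)
  ultimately obtain a where a: "a0 \<le> a" "\<phi> a = D\<^sup>2"
    using IVT2'[of \<phi> b "D\<^sup>2" a0] a0(2) b by blast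
  have "m < a"
    using a a0 a0m(1) by (metis order.strict_iff_order order.trans order.antisym)
  then show thesis using that a \<phi>_eq by metis
qed

section \<open>Maximising the constraint over a ball\<close>

lemma inner_feature_block: "feature blk X l t \<bullet> block blk t v = feature blk X l t \<bullet> v"
  unfolding feature_def block_def inner_vec_def by (rule sum.cong) auto

lemma norm_sq_blocks:
  fixes blk :: "'n::finite \<Rightarrow> 't::finite"
  shows "(\<Sum>t\<in>UNIV. (norm (block blk t v))\<^sup>2) = (norm v)\<^sup>2"
proof -
  have "(\<Sum>t\<in>UNIV. (norm (block blk t v))\<^sup>2) = (\<Sum>t\<in>UNIV. \<Sum>i\<in>UNIV. if blk i = t then (v $ i)\<^sup>2 else 0)"
    unfolding power2_norm_eq_inner inner_vec_def block_def
    by (intro sum.cong) (auto simp: power2_eq_square)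
  also have "\<dots> = (norm v)\<^sup>2"
    unfolding power2_norm_eq_inner inner_vec_def
    by (subst sum.swap) (simp add: power2_eq_square)
  finally show ?thesis .
qed

lemma norm_sq_vec: "(norm (v :: real^'t::finite))\<^sup>2 = (\<Sum>t\<in>UNIV. (v $ t)\<^sup>2)"
  unfolding power2_norm_eq_inner inner_vec_def by (simp add: power2_eq_square)

text \<open>Reduces the ball in the stacked space to a ball with one coordinate per task. Block
  norms of a displacement give the upper bound; a displacement along the features attains it.
  Entries of \<open>u\<close> may have any sign.\<close>

lemma arg_max_constr_ball:
  fixes blk :: "'n::finite \<Rightarrow> 't::finite" and X :: "real^'d::finite^'n"
    and l :: 'd and ctr :: "real^'n" and u :: "real^'t"
  defines "x \<equiv> feature blk X l"
  defines "f \<equiv> \<lambda>v :: real^'t. \<Sum>t\<in>UNIV. (\<bar>x t \<bullet> ctr\<bar> + norm (x t) * v $ t)\<^sup>2"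
  assumes u: "norm u \<le> \<Delta>" and max: "\<And>v. norm v \<le> \<Delta> \<Longrightarrow> f v \<le> f u"
  obtains \<theta> where "is_arg_max (constr blk X l) (\<lambda>\<theta>. norm (\<theta> - ctr) \<le> \<Delta>) \<theta>"
    "constr blk X l \<theta> = f u"
proof -
  have constr: "constr blk X l \<theta> = (\<Sum>t\<in>UNIV. (x t \<bullet> \<theta>)\<^sup>2)" for \<theta>
    by (simp add: constr_def inner_feature_block x_def)
  have upper: "constr blk X l \<theta> \<le> f u" if \<theta>: "norm (\<theta> - ctr) \<le> \<Delta>" for \<theta>
  proof -
    define s :: "real^'t" where "s = (\<chi> t. norm (block blk t (\<theta> - ctr)))"
    have "(norm s)\<^sup>2 = (norm (\<theta> - ctr))\<^sup>2"
      
      using norm_sq_blocks[of blk "\<theta> - ctr"] norm_sq_vec[of s] by (simp only: s_def vec_lambda_beta)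
    then have s: "norm s \<le> \<Delta>" using \<theta> by (simp add: power2_eq_iff_nonneg)
    have "constr blk X l \<theta> \<le> f s"
      unfolding constr f_def
    proof (rule sum_mono)
      fix t
      have "\<bar>x t \<bullet> (\<theta> - ctr)\<bar> \<le> norm (x t) * s $ t"
        using Cauchy_Schwarz_ineq2[of "x t" "block blk t (\<theta> - ctr)"]
        by (simp add: s_def x_def inner_feature_block)
      then have "\<bar>x t \<bullet> \<theta>\<bar> \<le> \<bar>x t \<bullet> ctr\<bar> + norm (x t) * s $ t"
        by (simp add: inner_diff_right)
      from power_mono[OF this, of 2]
      show "(x t \<bullet> \<theta>)\<^sup>2 \<le> (\<bar>x t \<bullet> ctr\<bar> + norm (x t) * s $ t)\<^sup>2" by simp
    qed
    also have "\<dots> \<le> f u" using max s .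
    finally show ?thesis .
  qed
  \<comment> \<open>The sign aligns the displacement with \<open>x t \<bullet> ctr\<close>,
    producing the absolute values in \<open>f\<close>. Its value 1 at zero, unlike that of
    \<open>sgn\<close>, ensures that its square is always 1.\<close>
  define \<sigma> where "\<sigma> t = (if 0 \<le> x t \<bullet> ctr then 1 else - 1 :: real)" for t
  \<comment> \<open>For \<open>x t = 0\<close> the division by zero yields a zero summand, which is
    why the norm of \<delta> is only bounded by that of \<open>u\<close>.\<close>
  define \<delta> where "\<delta> = (\<Sum>t\<in>UNIV. (\<sigma> t * u $ t / norm (x t)) *\<^sub>R x t)"
  have orth: "x s \<bullet> x t = (if s = t then (norm (x t))\<^sup>2 else 0)" for s t
    by (auto simp: power2_norm_eq_inner)
      (auto simp: x_def feature_def block_def inner_vec_def intro!: sum.neutral)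
  have x\<delta>: "x t \<bullet> \<delta> = \<sigma> t * u $ t * norm (x t)" for t
    by (simp add: \<delta>_def inner_sum_right orth if_distrib[of "\<lambda>z. _ * z"] power2_eq_square cong: if_cong)
  have "(norm \<delta>)\<^sup>2 = (\<Sum>t\<in>UNIV. (\<sigma> t * u $ t / norm (x t)) * (x t \<bullet> \<delta>))"
    unfolding power2_norm_eq_inner by (subst \<delta>_def, simp add: inner_sum_left)
  also have "\<dots> \<le> (\<Sum>t\<in>UNIV. (u $ t)\<^sup>2)"
    by (intro sum_mono) (auto simp: x\<delta> \<sigma>_def power2_eq_square)
  also have "\<dots> = (norm u)\<^sup>2" by (simp add: norm_sq_vec)
  finally have "norm \<delta> \<le> \<Delta>" using u by (simp add: abs_le_square_iff[symmetric])
  moreover have val: "constr blk X l (ctr + \<delta>) = f u"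
    unfolding constr f_def
  proof (rule sum.cong)
    fix t
    have "x t \<bullet> (ctr + \<delta>) = \<sigma> t * (\<bar>x t \<bullet> ctr\<bar> + norm (x t) * u $ t)"
      by (simp add: inner_add_right x\<delta> \<sigma>_def algebra_simps)
    then show "(x t \<bullet> (ctr + \<delta>))\<^sup>2 = (\<bar>x t \<bullet> ctr\<bar> + norm (x t) * u $ t)\<^sup>2"
      by (simp add: power_mult_distrib \<sigma>_def)
  qed simp
  ultimately show thesis
    using upper by (intro that[of "ctr + \<delta>"]) (auto simp: is_arg_max_def not_less)
qed

section \<open>Multiplier, optimal points and the maximum over the dual ball\<close>

theorem theorem7:
  fixes blk :: "'n::finite \<Rightarrow> 't::finite"
    and X :: "real^'d::finite^'n" and y :: "real^'n"
    and ls l :: 'd and lam lam0 \<Delta> \<rho> :: real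
    and ctr :: "real^'n" and x :: "'t \<Rightarrow> real^'n"
    and H :: "real^'t^'t" and q ubar u :: "real^'t"
    and I :: "'t set" and V :: "(real^'t) set"
  assumes "surj blk"
    and "is_arg_max (\<lambda>k. constr blk X k y) (\<lambda>k. True) ls"
    and "0 < lam" and "lam < lam0" and "lam0 \<le> lambda_max blk X y"
    and "ctr = center blk X y ls lam lam0"
    and "\<Delta> = (1/2) * norm (resid_perp blk X y ls lam lam0)"
    and "0 < \<Delta>"
    and "x = feature blk X l"
    and "H = - (\<chi> i j. if i = j then 2 * (norm (x i))\<^sup>2 else 0)"
    and "q = - (\<chi> t. 2 * norm (x t) * \<bar>x t \<bullet> block blk t ctr\<bar>)"
    and "\<rho> = (MAX t. norm (x t))"
    and "I = {t. norm (x t) = \<rho>}"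
    and "ubar = (\<chi> t. if t \<notin> I then - q $ t / (H $ t $ t + 2 * \<rho>\<^sup>2) else 0)"
    and "V = {v. (\<forall>t. t \<notin> I \<longrightarrow> v $ t = 0) \<and> norm (ubar + v) = \<Delta>}"
    and "tr_optimal H q \<Delta> u"
  shows "(\<forall>w. tr_optimal H q \<Delta> w \<longleftrightarrow> norm w \<le> \<Delta> \<and> (\<exists>\<beta>. tr_multiplier H q \<Delta> w \<beta>)) \<and>
    (\<exists>\<alpha>.
       (\<forall>w \<beta>. tr_optimal H q \<Delta> w \<longrightarrow> (tr_multiplier H q \<Delta> w \<beta> \<longleftrightarrow> \<beta> = \<alpha>)) \<and>
       2 * \<rho>\<^sup>2 \<le> \<alpha> \<and>
       (if norm ubar \<le> \<Delta> \<and> (\<forall>t\<in>I. x t \<bullet> block blk t ctr = 0)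
        then \<alpha> = 2 * \<rho>\<^sup>2 else 2 * \<rho>\<^sup>2 < \<alpha>) \<and>
       (\<alpha> = 2 * \<rho>\<^sup>2 \<longrightarrow> 0 < \<rho> \<or> norm u = \<Delta> \<longrightarrow> u \<in> {ubar + v | v. v \<in> V}) \<and>
       (\<alpha> \<noteq> 2 * \<rho>\<^sup>2 \<longrightarrow> invertible (H + \<alpha> *\<^sub>R mat 1) \<and>
                       u = - (matrix_inv (H + \<alpha> *\<^sub>R mat 1) *v q)) \<and>
       (\<exists>\<theta>. is_arg_max (constr blk X l) (\<lambda>\<theta>. \<theta> \<in> dual_ball blk X y ls lam lam0) \<theta> \<and>
            constr blk X l \<theta> =
              (\<Sum>t\<in>UNIV. (x t \<bullet> block blk t ctr)\<^sup>2) + \<alpha> / 2 * \<Delta>\<^sup>2 - (1/2) * (q \<bullet> u)))"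
proof -
  define c where "c t = x t \<bullet> block blk t ctr" for t
  \<comment> \<open>With \<open>d\<close> as the negated diagonal of \<open>H\<close> and
    \<open>m\<close> as its largest entry, the shifted matrix has diagonal \<open>b - d t\<close>,
    so it is positive semidefinite once \<open>b \<ge> m\<close>.\<close>
  define d where "d t = 2 * (norm (x t))\<^sup>2" for t
  define m where "m = 2 * \<rho>\<^sup>2"
  have \<Delta>: "0 < \<Delta>" and opt: "tr_optimal H q \<Delta> u" by fact+
  have nx: "norm (x t) \<le> \<rho>" for t
    using assms(12) by simp
  obtain t0 where t0: "norm (x t0) = \<rho>"
    using Max_in[of "range (\<lambda>t. norm (x t))"] assms(12) by (auto simp: image_iff)
  have dm: "d t \<le> m" for t
    using nx[of t] by (simp add: d_def m_def power_mono)
  have m0: "0 \<le> m" by (simp add: m_def)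
  have I: "t \<in> I \<longleftrightarrow> d t = m" for t
    using order.trans[OF norm_ge_zero nx[of t]] assms(13)
    by (simp add: d_def m_def power2_eq_iff_nonneg)
  have notI: "t \<notin> I \<longleftrightarrow> d t < m" for t
    using dm[of t] by (simp add: I less_le)
  have Hb: "H + b *\<^sub>R mat 1 = (\<chi> i j. if i = j then b - d i else 0)" for b
    by (auto simp: assms(10) vec_eq_iff mat_def d_def)
  have qt: "q $ t = - (2 * norm (x t) * \<bar>c t\<bar>)" for t
    by (simp add: assms(11) c_def)
  have q0: "q $ t = 0 \<longleftrightarrow> c t = 0" for t
    by (auto simp: qt c_def)
  have Htt: "H $ t $ t + 2 * \<rho>\<^sup>2 = m - d t" for t
    by (simp add: assms(10) d_def m_def)
  have ubar: "ubar $ t = (if d t < m then - q $ t / (m - d t) else 0)" for t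
    by (simp add: assms(14) notI Htt)
  let ?deg = "norm ubar \<le> \<Delta> \<and> (\<forall>t\<in>I. c t = 0)"

  \<comment> \<open>It suffices to exhibit one point with a suitable multiplier; the multiplier then
    passes to every optimal point, in particular to \<open>u\<close>.\<close>
  have "\<exists>a w. m \<le> a \<and> (if ?deg then a = m else m < a) \<and> norm w = \<Delta> \<and> tr_multiplier H q \<Delta> w a"
  proof (cases ?deg)
    case True
    \<comment> \<open>At \<open>a = m\<close> the shifted matrix annihilates the coordinates in
      \<open>I\<close>, where \<open>ubar\<close> is zero. Moving \<open>ubar\<close> along
      \<open>t0\<close> therefore keeps stationarity, and by Pythagoras \<open>s\<close> is the
      length that reaches the sphere.\<close>
    define s where "s = sqrt (\<Delta>\<^sup>2 - (norm ubar)\<^sup>2)"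
    define w where "w = ubar + axis t0 s"
    have dt0: "d t0 = m" using t0 by (simp add: d_def m_def)
    have "ubar \<bullet> axis t0 s = 0" by (simp add: inner_axis ubar dt0)
    then have "(norm w)\<^sup>2 = (norm ubar)\<^sup>2 + s\<^sup>2"
      unfolding w_def power2_norm_eq_inner
      by (simp add: inner_add inner_commute inner_axis_axis power2_eq_square)
    also have "\<dots> = \<Delta>\<^sup>2"
      using True \<Delta> by (simp add: s_def power_mono)
    finally have nw: "norm w = \<Delta>" using \<Delta> by (simp add: power2_eq_iff_nonneg)
    have "(m - d t) * w $ t = - q $ t" for t
      using True I[of t] dm[of t] dt0 q0[of t]
      by (auto simp: w_def axis_def ubar)
    then have "(H + m *\<^sub>R mat 1) *v w = - q"
      unfolding Hb diagonal_mult by (simp add: vec_eq_iff)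
    then have "tr_multiplier H q \<Delta> w m"
      unfolding tr_multiplier_def using m0 nw dm Hb by (simp add: diagonal_pos_semidef)
    then show ?thesis using True nw by auto
  next
    case False
    have "(norm ubar)\<^sup>2 = (\<Sum>t\<in>UNIV. (if d t < m then q $ t / (m - d t) else 0)\<^sup>2)"
      by (auto simp: norm_sq_vec ubar power_divide intro!: sum.cong)
    moreover have "norm ubar \<le> \<Delta> \<longleftrightarrow> (norm ubar)\<^sup>2 \<le> \<Delta>\<^sup>2"
      using \<Delta> by (simp add: abs_le_square_iff[symmetric])
    ultimately have "\<not> ((\<Sum>t\<in>UNIV. (if d t < m then q $ t / (m - d t) else 0)\<^sup>2) \<le> \<Delta>\<^sup>2 \<and>
                  (\<forall>t. d t = m \<longrightarrow> q $ t = 0))"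
      using False I q0 by auto
    then obtain a where a: "m < a" "(\<Sum>t\<in>UNIV. (q $ t / (a - d t))\<^sup>2) = \<Delta>\<^sup>2"
      using secular_equation[of d m \<Delta> "\<lambda>t. q $ t"] dm \<Delta> by blast
    have pos: "0 < a - d t" for t using a dm[of t] by simp
    \<comment> \<open>For \<open>a > m\<close> the shifted matrix is nonsingular and
      \<open>w\<close> is forced by stationarity; the secular equation says exactly that its norm is
      \<open>\<Delta>\<close>.\<close>
    define w where "w = (\<chi> t. - q $ t / (a - d t))"
    have "(norm w)\<^sup>2 = \<Delta>\<^sup>2" using a by (simp add: norm_sq_vec w_def)
    then have nw: "norm w = \<Delta>" using \<Delta> by (simp add: power2_eq_iff_nonneg)
    have "(a - d t) * w $ t = - q $ t" for t
      using pos[of t] by (simp add: w_def)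
    then have "(H + a *\<^sub>R mat 1) *v w = - q"
      unfolding Hb diagonal_mult by (simp add: vec_eq_iff)
    then have "tr_multiplier H q \<Delta> w a"
      unfolding tr_multiplier_def using m0 nw a(1) pos Hb
      by (simp add: diagonal_pos_semidef less_imp_le)
    then show ?thesis using False nw a(1) by (intro exI[of _ a] exI[of _ w]) auto
  qed
  then obtain \<alpha> w0 where \<alpha>: "m \<le> \<alpha>" "if ?deg then \<alpha> = m else m < \<alpha>"
    and w0: "norm w0 = \<Delta>" "tr_multiplier H q \<Delta> w0 \<alpha>"
    by blast
  have mult: "tr_multiplier H q \<Delta> w \<alpha>" if "tr_optimal H q \<Delta> w" for w
    using tr_multiplier_all_optimal[OF w0(2) _ that] w0(1) by simp
  have u: "norm u \<le> \<Delta>"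
    using opt by (simp add: tr_optimal_def is_arg_min_def)
  have stat: "(\<alpha> - d t) * u $ t = - q $ t" for t
    using mult[OF opt] unfolding tr_multiplier_def Hb diagonal_mult by (simp add: vec_eq_iff)

  have first: "tr_optimal H q \<Delta> w \<longleftrightarrow> norm w \<le> \<Delta> \<and> (\<exists>\<beta>. tr_multiplier H q \<Delta> w \<beta>)" for w
    using mult tr_multiplier_imp_optimal unfolding tr_optimal_def is_arg_min_def by metis
  have unique: "tr_multiplier H q \<Delta> w \<beta> \<longleftrightarrow> \<beta> = \<alpha>" if "tr_optimal H q \<Delta> w" for w \<beta>
    using mult[OF that] tr_multiplier_unique \<Delta> by blast
  \<comment> \<open>If \<open>\<rho> = 0\<close>, all features of \<open>l\<close> vanish, the
    objective is zero and every point of the ball is optimal, so the sphere condition in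
    \<open>V\<close> has to be supplied. If \<open>\<rho> > 0\<close>, it follows from
    complementarity.\<close>
  have third: "u \<in> {ubar + v | v. v \<in> V}" if "\<alpha> = m" "0 < \<rho> \<or> norm u = \<Delta>"
  proof -
    have "norm u = \<Delta>"
      using that mult[OF opt] by (auto simp: tr_multiplier_def m_def)
    \<comment> \<open>Off \<open>I\<close> the factor \<open>m - d t\<close> is positive, so
      stationarity determines the coordinate; on \<open>I\<close> it stays free.\<close>
    moreover have "(u - ubar) $ t = 0" if "t \<notin> I" for t
      using stat[of t] that \<open>\<alpha> = m\<close> by (simp add: notI ubar field_simps)
    ultimately have "u - ubar \<in> V" by (simp add: assms(15))
    then show ?thesis by (intro CollectI exI[of _ "u - ubar"]) simp
  qed
  have regular: "invertible (H + \<alpha> *\<^sub>R mat 1) \<and> u = - (matrix_inv (H + \<alpha> *\<^sub>R mat 1) *v q)"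
    if "\<alpha> \<noteq> m"
  proof -
    have "\<alpha> - d t \<noteq> 0" for t using that \<alpha>(1) dm[of t] by simp
    then have inv: "invertible (H + \<alpha> *\<^sub>R mat 1)"
      unfolding Hb by (rule diagonal_invertible)
    have "(H + \<alpha> *\<^sub>R mat 1) *v (- u) = q"
      using mult[OF opt]
      by (simp only: tr_multiplier_def linear_neg[OF matrix_vector_mul_linear] minus_minus)
    then show ?thesis
      using inv matrix_inv_mult_vector[OF inv, of "- u"] by simp
  qed

  \<comment> \<open>Expanding the square explains \<open>H\<close> and \<open>q\<close>: the
    quadratic coefficient \<open>(norm (x t))\<^sup>2\<close> is minus half the diagonal entry, and
    the linear coefficient is \<open>- q $ t\<close>. Minimising the trust region objective thus
    maximises this sum.\<close>
  have obj: "(\<Sum>t\<in>UNIV. (\<bar>x t \<bullet> ctr\<bar> + norm (x t) * v $ t)\<^sup>2)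
      = (\<Sum>t\<in>UNIV. (c t)\<^sup>2) - tr_objective H q v" for v
  proof -
    have H: "H = (\<chi> i j. if i = j then - d i else 0)"
      by (auto simp: assms(10) d_def vec_eq_iff)
    have "x t \<bullet> ctr = c t" for t
      by (simp add: c_def assms(9) inner_feature_block)
    then show ?thesis
      unfolding tr_objective_def H diagonal_mult inner_vec_def
      by (simp add: qt d_def sum_distrib_left sum.distrib[symmetric] sum_subtractf[symmetric]
          sum_negf[symmetric] power2_eq_square algebra_simps)
  qed
  have "tr_objective H q u \<le> tr_objective H q v" if "norm v \<le> \<Delta>" for v
    using opt that by (auto simp: tr_optimal_def is_arg_min_def not_less)
  then obtain \<theta> where \<theta>: "is_arg_max (constr blk X l) (\<lambda>\<theta>. norm (\<theta> - ctr) \<le> \<Delta>) \<theta>"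
      "constr blk X l \<theta> = (\<Sum>t\<in>UNIV. (c t)\<^sup>2) - tr_objective H q u"
    using arg_max_constr_ball[of u \<Delta> blk X l ctr] u obj
    unfolding assms(9)[symmetric] by auto
  have ball: "(\<theta>' \<in> dual_ball blk X y ls lam lam0) = (norm (\<theta>' - ctr) \<le> \<Delta>)" for \<theta>'
    by (simp add: dual_ball_def assms(6,7))
  have fourth: "\<exists>\<theta>. is_arg_max (constr blk X l) (\<lambda>\<theta>. \<theta> \<in> dual_ball blk X y ls lam lam0) \<theta> \<and>
      constr blk X l \<theta> = (\<Sum>t\<in>UNIV. (c t)\<^sup>2) + \<alpha> / 2 * \<Delta>\<^sup>2 - (1/2) * (q \<bullet> u)"
    using \<theta> tr_objective_multiplier[OF mult[OF opt]] by (intro exI[of _ \<theta>]) (simp add: ball)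
  show ?thesis
    unfolding c_def[symmetric] m_def[symmetric]
    using first unique \<alpha> third regular fourth by blast
qed

end
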